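(* Let $\mathcal{X}$ be a p-adic Hilbert space and let $T:\mathcal{X}\to\mathcal{X}$ be a magic contraction, with associated self-adjoint bounded linear operators $M_T, M_{T^*}:\mathcal{X}\to\mathcal{X}$ (satisfying $M_T^2=I_\mathcal{X}-T^*T$, $M_{T^*}^2=I_\mathcal{X}-TT^*$, $TM_T=M_{T^*}T$). Let $U:=(u_{n,m})_{n,m\in\mathbb{Z}}$ be the operator on $\oplus_{n=-\infty}^{\infty}\mathcal{X}$ given by the infinite matrix with entries $$u_{0,0}:=T,\quad u_{0,1}:=M_{T^*},\quad u_{-1,0}:=M_T,\quad u_{-1,1}:=-T^*,$$ $$u_{n,n+1}:=I_\mathcal{X}\quad\text{for all }n\in\mathbb{Z},\ n\ne -1,0,\qquad u_{n,m}:=0\ \text{ otherwise}.$$ Then $U$ is unitary on $\oplus_{n=-\infty}^{\infty}\mathcal{X}$ and $$T^n=P_\mathcal{X}U^n|_\mathcal{X}\quad\text{and}\quad(T^* )^n=P_\mathcal{X}(U^* )^n|_\mathcal{X}\qquad\text{for all }n\in\mathbb{N},$$ where $P_\mathcal{X}:\oplus_{n=-\infty}^{\infty}\mathcal{X}\ni(x_n)_{n=-\infty}^{\infty}\mapsto x_0\in\mathcal{X}$ and $|_\mathcal{X}$ denotes restriction to $\mathcal{X}$ embedded as the summand of index $0$.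
   Context: p-adic Hilbert space: Let $\mathbb{K}$ be a complete non-Archimedean valued field with valuation $|\cdot|$, and let $\mathcal{X}$ be a non-Archimedean Banach space over $\mathbb{K}$ with norm $\|\cdot\|$. $\mathcal{X}$ is a p-adic Hilbert space if there is a map (inner product) $\langle\cdot,\cdot\rangle:\mathcal{X}\times\mathcal{X}\to\mathbb{K}$ such that (i) if $\langle x,y\rangle=0$ for all $y\in\mathcal{X}$ then $x=0$; (ii) $\langle x,y\rangle=\langle y,x\rangle$ for all $x,y$; (iii) $\langle\alpha x+y,z\rangle=\alpha\langle x,z\rangle+\langle y,z\rangle$ for all $\alpha\in\mathbb{K}$ and $x,y,z\in\mathcal{X}$; (iv) $|\langle x,y\rangle|\le\|x\|\|y\|$ for all $x,y$. Operators: a bounded linear operator $T:\mathcal{X}\to\mathcal{X}$ is adjointable if there is a bounded linear operator $T^*:\mathcal{X}\to\mathcal{X}$ with $\langle Tx,y\rangle=\langle x,T^*y\rangle$ for all $x,y\in\mathcal{X}$ (it is then unique). An adjointable $T$ is self-adjoint if $T^*=T$; an adjointable $U$ is unitary if $UU^*=U^*U=I_\mathcal{X}$, the identity operator on $\mathcal{X}$. Magic contraction: a bounded linear adjointable operator $T:\mathcal{X}\to\mathcal{X}$ is a magic contraction if there are self-adjoint bounded linear operators $M_T, M_{T^*}:\mathcal{X}\to\mathcal{X}$ (not necessarily unique) such that $M_T^2=I_\mathcal{X}-T^*T$, $M_{T^*}^2=I_\mathcal{X}-TT^*$ and $TM_T=M_{T^*}T$. The space $\oplus_{n=-\infty}^{\infty}\mathcal{X}:=\{(x_n)_{n\in\mathbb{Z}}: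 x_n\in\mathcal{X},\ \lim_{|n|\to\infty}\|x_n\|=0\}$ is a p-adic Hilbert space with norm $\|(x_n)_n\|:=\sup_{n\in\mathbb{Z}}\|x_n\|$ and inner product $\langle(x_n)_n,(y_n)_n\rangle:=\sum_{n=-\infty}^{\infty}\langle x_n,y_n\rangle$. A matrix $(u_{n,m})$ of operators acts by $(U(x_m)_m)_n=\sum_m u_{n,m}x_m$, so here $(Ux)_{-1}=M_Tx_0-T^*x_1$, $(Ux)_0=Tx_0+M_{T^*}x_1$, and $(Ux)_n=x_{n+1}$ for $n\ne-1,0$. *)

theory Defs
  imports "HOL-Analysis.Analysis"
begin

section \<open>Non-Archimedean normed groups, Banach groups and valued fields\<close>

text \<open>
  The library constant \<open>norm\<close> is restricted to real normed vector spaces, hence the separate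
  constant \<open>unorm\<close>.  The classes below carry the part of the structure that involves only one
  type (norm, metric, topology, completeness); scalar multiplication over a field \<open>'k\<close> is
  added in the locale \<open>nonarch_banach_space\<close>.  The axiom \<open>nonarch_norm_minus\<close> is
  automatic for a valued field and for a normed space over one; it is stated only because scalars
  are not available here.
\<close>

class nonarch_normed_group = ab_group_add + metric_space +
  fixes unorm :: "'a \<Rightarrow> real"
  assumes dist_unorm: "dist x y = unorm (x - y)"
    and nonarch_norm_eq_0_iff: "unorm x = 0 \<longleftrightarrow> x = 0"
    and nonarch_norm_minus: "unorm (- x) = unorm x"
    and nonarch_norm_add: "unorm (x + y) \<le> max (unorm x) (unorm y)"
begin

lemma nonarch_norm_zero: "unorm 0 = 0"
  by (simp add: nonarch_norm_eq_0_iff)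

lemma nonarch_norm_ge_0: "0 \<le> unorm x"
  using nonarch_norm_add[of x "- x"] by (simp add: nonarch_norm_minus nonarch_norm_zero)

lemma nonarch_norm_diff: "unorm (x - y) \<le> max (unorm x) (unorm y)"
  using nonarch_norm_add[of x "- y"] by (simp add: nonarch_norm_minus)

lemma nonarch_norm_diff_commute: "unorm (x - y) = unorm (y - x)"
  using nonarch_norm_minus[of "x - y"] by simp

end

class nonarch_banach_group = nonarch_normed_group + complete_space

class nonarch_valued_field = field + nonarch_banach_group +
  assumes nonarch_norm_mult: "unorm (x * y) = unorm x * unorm y"

lemma tendsto_nonarch_iff:
  fixes f :: "'b \<Rightarrow> 'a::nonarch_normed_group"
  shows "(f \<longlongrightarrow> l) F \<longleftrightarrow> ((\<lambda>x. unorm (f x - l)) \<longlongrightarrow> 0) F"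
  by (subst tendsto_dist_iff) (simp add: dist_unorm)

instance nonarch_normed_group \<subseteq> topological_ab_group_add
proof
  fix a b :: 'a
  show "LIM x (nhds a \<times>\<^sub>F nhds b). fst x + snd x :> nhds (a + b)"
    unfolding tendsto_iff
  proof safe
    fix e :: real assume e: "e > 0"
    have "eventually (\<lambda>x. dist x c < e) (nhds c)" for c :: 'a
      using e by (auto simp: eventually_nhds_metric)
    then have "eventually (\<lambda>x. dist (fst x) a < e \<and> dist (snd x) b < e) (nhds a \<times>\<^sub>F nhds b)"
      unfolding eventually_prod_filter by fastforce
    then show "eventually (\<lambda>x. dist (fst x + snd x) (a + b) < e) (nhds a \<times>\<^sub>F nhds b)"
    proof eventually_elim
      case (elim x)
      have "fst x + snd x - (a + b) = (fst x - a) + (snd x - b)" by simp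
      then have "unorm (fst x + snd x - (a + b)) \<le> max (unorm (fst x - a)) (unorm (snd x - b))"
        by (metis nonarch_norm_add)
      with elim show ?case by (auto simp: dist_unorm)
    qed
  qed
  show "(uminus \<longlongrightarrow> - a) (nhds a)"
  proof -
    have "((\<lambda>x. x) \<longlongrightarrow> a) (nhds a)" by (simp add: filterlim_ident)
    then show ?thesis
      unfolding tendsto_nonarch_iff
      by (rule Lim_transform_eventually)
         (metis (mono_tags, lifting) always_eventually minus_diff_minus nonarch_norm_minus)
  qed
qed

lemma nonarch_norm_sum_le:
  fixes f :: "'b \<Rightarrow> 'a::nonarch_normed_group"
  assumes "\<And>i. i \<in> A \<Longrightarrow> unorm (f i) \<le> B" "0 \<le> B"
  shows "unorm (sum f A) \<le> B"
  using assms
proof (induction A rule: infinite_finite_induct)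
  case (insert x A)
  then show ?case
    using nonarch_norm_add[of "f x" "sum f A"] by (auto intro: order_trans)
qed (auto simp: nonarch_norm_zero)

lemma nonarch_norm_has_sum_le:
  fixes f :: "'b \<Rightarrow> 'a::nonarch_normed_group"
  assumes "(f has_sum s) A" "\<And>i. i \<in> A \<Longrightarrow> unorm (f i) \<le> B" "0 \<le> B"
  shows "unorm s \<le> B"
proof -
  have "((\<lambda>F. dist (sum f F) 0) \<longlongrightarrow> dist s 0) (finite_subsets_at_top A)"
    using assms(1) by (intro tendsto_intros) (simp add: has_sum_def)
  moreover have "eventually (\<lambda>F. dist (sum f F) 0 \<le> B) (finite_subsets_at_top A)"
    using assms by (intro eventually_finite_subsets_at_top_weakI)
      (auto simp: dist_unorm intro!: nonarch_norm_sum_le)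
  ultimately have "dist s 0 \<le> B"
    using finite_subsets_at_top_neq_bot tendsto_upperbound by blast
  then show ?thesis by (simp add: dist_unorm)
qed

lemma nonarch_summableI:
  fixes f :: "'b \<Rightarrow> 'a::nonarch_banach_group"
  assumes "\<And>e. e > 0 \<Longrightarrow> finite {i. unorm (f i) \<ge> e}"
  shows "f summable_on UNIV"
proof -
  let ?G = "filtermap (sum f) (finite_subsets_at_top UNIV)"
  have "cauchy_filter ?G"
    unfolding cauchy_filter_metric_filtermap
  proof safe
    fix e :: real assume e: "e > 0"
    define E where "E = {i. unorm (f i) \<ge> e/2}"
    have fin: "finite E" using assms[of "e/2"] e by (simp add: E_def)
    define P where "P = (\<lambda>F. finite F \<and> E \<subseteq> F)"
    have "eventually P (finite_subsets_at_top UNIV)"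
      unfolding P_def eventually_finite_subsets_at_top using fin by auto
    moreover have "dist (sum f F) (sum f G) < e" if "P F" "P G" for F G
    proof -
      have *: "unorm (sum f F - sum f E) \<le> e/2" if "P F" for F
      proof -
        have "sum f F - sum f E = sum f (F - E)"
          using that fin by (simp add: P_def sum_diff)
        also have "unorm \<dots> \<le> e/2"
          by (rule nonarch_norm_sum_le) (use e in \<open>auto simp: E_def\<close>)
        finally show ?thesis .
      qed
      have "sum f F - sum f G = (sum f F - sum f E) - (sum f G - sum f E)" by simp
      then have "unorm (sum f F - sum f G) \<le> e/2"
        using nonarch_norm_diff[of "sum f F - sum f E" "sum f G - sum f E"] *[OF that(1)]
          *[OF that(2)] by simp
      with e show ?thesis by (simp add: dist_unorm)
    qed
    ultimately show "\<exists>P. eventually P (finite_subsets_at_top UNIV) \<and>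
        (\<forall>x y. P x \<and> P y \<longrightarrow> dist (sum f x) (sum f y) < e)"
      by blast
  qed
  moreover have "?G \<noteq> bot" by (simp add: filtermap_bot_iff)
  ultimately obtain L where "?G \<le> nhds L"
    using cauchy_filter_complete_converges[of ?G UNIV] complete_UNIV_cuspace by auto
  then show ?thesis
    by (auto simp: summable_on_def has_sum_def filterlim_def)
qed


section \<open>p-adic Hilbert spaces and their operators\<close>

locale nonarch_banach_space = vector_space smul
  for smul :: "'k::nonarch_valued_field \<Rightarrow> 'x::nonarch_banach_group \<Rightarrow> 'x" +
  assumes norm_smul: "unorm (smul a x) = unorm a * unorm x"

locale padic_hilbert_space = nonarch_banach_space smul
  for smul :: "'k::nonarch_valued_field \<Rightarrow> 'x::nonarch_banach_group \<Rightarrow> 'x" +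
  fixes ip :: "'x \<Rightarrow> 'x \<Rightarrow> 'k"
  assumes ip_nondegenerate: "(\<And>y. ip x y = 0) \<Longrightarrow> x = 0"
    and ip_sym: "ip x y = ip y x"
    and ip_linear: "ip (smul a x + y) z = a * ip x z + ip y z"
    and ip_bound: "unorm (ip x y) \<le> unorm x * unorm y"

definition bounded_linear_op ::
  "('k::nonarch_valued_field \<Rightarrow> 'x::nonarch_banach_group \<Rightarrow> 'x) \<Rightarrow> ('x \<Rightarrow> 'x) \<Rightarrow> bool"
  where "bounded_linear_op smul T \<longleftrightarrow>
    Vector_Spaces.linear smul smul T \<and> (\<exists>C. \<forall>x. unorm (T x) \<le> C * unorm x)"

definition is_adjoint ::
  "('k::nonarch_valued_field \<Rightarrow> 'x::nonarch_banach_group \<Rightarrow> 'x) \<Rightarrow> ('x \<Rightarrow> 'x \<Rightarrow> 'k) \<Rightarrow>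
    ('x \<Rightarrow> 'x) \<Rightarrow> ('x \<Rightarrow> 'x) \<Rightarrow> bool"
  where "is_adjoint smul ip T S \<longleftrightarrow>
    bounded_linear_op smul S \<and> (\<forall>x y. ip (T x) y = ip x (S y))"

definition adjointable ::
  "('k::nonarch_valued_field \<Rightarrow> 'x::nonarch_banach_group \<Rightarrow> 'x) \<Rightarrow> ('x \<Rightarrow> 'x \<Rightarrow> 'k) \<Rightarrow>
    ('x \<Rightarrow> 'x) \<Rightarrow> bool"
  where "adjointable smul ip T \<longleftrightarrow>
    bounded_linear_op smul T \<and> (\<exists>S. is_adjoint smul ip T S)"

text \<open>Meaningful for adjointable operators on a p-adic Hilbert space only.\<close>

definition adj ::
  "('k::nonarch_valued_field \<Rightarrow> 'x::nonarch_banach_group \<Rightarrow> 'x) \<Rightarrow> ('x \<Rightarrow> 'x \<Rightarrow> 'k) \<Rightarrow>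
    ('x \<Rightarrow> 'x) \<Rightarrow> 'x \<Rightarrow> 'x"
  where "adj smul ip T = (THE S. is_adjoint smul ip T S)"

definition self_adjoint ::
  "('k::nonarch_valued_field \<Rightarrow> 'x::nonarch_banach_group \<Rightarrow> 'x) \<Rightarrow> ('x \<Rightarrow> 'x \<Rightarrow> 'k) \<Rightarrow>
    ('x \<Rightarrow> 'x) \<Rightarrow> bool"
  where "self_adjoint smul ip T \<longleftrightarrow> adjointable smul ip T \<and> adj smul ip T = T"

definition unitary ::
  "('k::nonarch_valued_field \<Rightarrow> 'x::nonarch_banach_group \<Rightarrow> 'x) \<Rightarrow> ('x \<Rightarrow> 'x \<Rightarrow> 'k) \<Rightarrow>
    ('x \<Rightarrow> 'x) \<Rightarrow> bool"
  where "unitary smul ip U \<longleftrightarrow>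
    adjointable smul ip U \<and> U \<circ> adj smul ip U = id \<and> adj smul ip U \<circ> U = id"

text \<open>\<open>M\<close> and \<open>N\<close> play the roles of $M_T$ and $M_{T^*}$.\<close>

definition magic_roots ::
  "('k::nonarch_valued_field \<Rightarrow> 'x::nonarch_banach_group \<Rightarrow> 'x) \<Rightarrow> ('x \<Rightarrow> 'x \<Rightarrow> 'k) \<Rightarrow>
    ('x \<Rightarrow> 'x) \<Rightarrow> ('x \<Rightarrow> 'x) \<Rightarrow> ('x \<Rightarrow> 'x) \<Rightarrow> bool"
  where "magic_roots smul ip T M N \<longleftrightarrow>
    self_adjoint smul ip M \<and> self_adjoint smul ip N \<and>
    M \<circ> M = (\<lambda>x. x - adj smul ip T (T x)) \<and>
    N \<circ> N = (\<lambda>x. x - T (adj smul ip T x)) \<and>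
    T \<circ> M = N \<circ> T"

definition magic_contraction ::
  "('k::nonarch_valued_field \<Rightarrow> 'x::nonarch_banach_group \<Rightarrow> 'x) \<Rightarrow> ('x \<Rightarrow> 'x \<Rightarrow> 'k) \<Rightarrow>
    ('x \<Rightarrow> 'x) \<Rightarrow> bool"
  where "magic_contraction smul ip T \<longleftrightarrow>
    adjointable smul ip T \<and> (\<exists>M N. magic_roots smul ip T M N)"

context padic_hilbert_space
begin

lemma ip_add_left: "ip (x + y) z = ip x z + ip y z"
  using ip_linear[of 1 x y z] by simp

lemma ip_zero_left: "ip 0 z = 0"
proof -
  have "ip 0 z = ip 0 z + ip 0 z" using ip_add_left[of 0 0 z] by (simp only: add_0_left)
  then show ?thesis by (simp only: add_cancel_right_right)
qed

lemma ip_scale_left: "ip (smul a x) z = a * ip x z"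
  using ip_linear[of a x 0 z] by (simp add: ip_zero_left)

lemma ip_add_right: "ip z (x + y) = ip z x + ip z y"
  by (metis ip_add_left ip_sym)

lemma ip_diff_right: "ip z (x - y) = ip z x - ip z y"
  by (metis add_diff_cancel_right' diff_add_cancel ip_add_right)

lemma is_adjoint_unique:
  assumes "is_adjoint smul ip T S" "is_adjoint smul ip T S'"
  shows "S = S'"
proof
  fix y
  have "ip (S y - S' y) x = 0" for x
    using assms by (metis diff_self ip_diff_right ip_sym is_adjoint_def)
  then have "S y - S' y = 0" by (rule ip_nondegenerate)
  then show "S y = S' y" by simp
qed

lemma adj_eqI: "is_adjoint smul ip T S \<Longrightarrow> adj smul ip T = S"
  unfolding adj_def using is_adjoint_unique by blast

lemma is_adjoint_adj: "adjointable smul ip T \<Longrightarrow> is_adjoint smul ip T (adj smul ip T)"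
  unfolding adjointable_def using adj_eqI by metis

end


section \<open>The direct sum over the integers\<close>

typedef (overloaded) 'x zsum =
  "{x :: int \<Rightarrow> 'x::nonarch_normed_group.
     ((\<lambda>n. unorm (x n)) \<longlongrightarrow> 0) (filtercomap abs at_top)}"
  morphisms zcoord Abs_zsum
  by (rule exI[of _ "\<lambda>_. 0"]) (simp add: nonarch_norm_zero)

setup_lifting type_definition_zsum

lemma filtercomap_abs_int_at_top: "filtercomap abs at_top = (cofinite :: int filter)"
proof (rule filter_eqI)
  fix P :: "int \<Rightarrow> bool"
  have "eventually P (filtercomap abs at_top) \<longleftrightarrow> (\<exists>N. \<forall>n. \<bar>n\<bar> \<ge> N \<longrightarrow> P n)"
    unfolding eventually_filtercomap eventually_at_top_linorder by (metis abs_ge_self)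
  also have "\<dots> \<longleftrightarrow> finite {n. \<not> P n}"
  proof
    assume "\<exists>N. \<forall>n. \<bar>n\<bar> \<ge> N \<longrightarrow> P n"
    then obtain N where "\<And>n. \<bar>n\<bar> \<ge> N \<Longrightarrow> P n" by blast
    then have "{n. \<not> P n} \<subseteq> {-N..N}" by (force simp: abs_le_iff)
    then show "finite {n. \<not> P n}" using finite_subset by blast
  next
    assume "finite {n. \<not> P n}"
    then have "finite (abs ` {n. \<not> P n})" by simp
    then obtain N where "\<And>m. m \<in> abs ` {n. \<not> P n} \<Longrightarrow> m \<le> N"
      by (meson bdd_above_finite bdd_above_def)
    then have "\<forall>n. \<bar>n\<bar> \<ge> N + 1 \<longrightarrow> P n" by fastforce
    then show "\<exists>N. \<forall>n. \<bar>n\<bar> \<ge> N \<longrightarrow> P n" by blast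
  qed
  also have "\<dots> \<longleftrightarrow> eventually P cofinite" by (simp add: eventually_cofinite)
  finally show "eventually P (filtercomap abs at_top) \<longleftrightarrow> eventually P cofinite" .
qed

lemma zsum_limit_iff:
  fixes x :: "int \<Rightarrow> 'x::nonarch_normed_group"
  shows "((\<lambda>n. unorm (x n)) \<longlongrightarrow> 0) (filtercomap abs at_top) \<longleftrightarrow>
    (\<forall>e>0. finite {n. unorm (x n) \<ge> e})"
  unfolding filtercomap_abs_int_at_top tendsto_iff
  by (simp add: eventually_cofinite dist_real_def nonarch_norm_ge_0 not_less)

lemma finite_zcoord_ge: "e > 0 \<Longrightarrow> finite {n. unorm (zcoord x n) \<ge> e}"
  using zcoord[of x] by (simp add: zsum_limit_iff)

lemma zcoord_Abs_zsum:
  assumes "\<And>e. e > 0 \<Longrightarrow> finite {n. unorm (x n) \<ge> e}"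
  shows "zcoord (Abs_zsum x) = x"
  using assms by (subst Abs_zsum_inverse) (auto simp: zsum_limit_iff)

lemma bdd_above_zcoord: "bdd_above (range (\<lambda>n. unorm (zcoord x n)))"
proof -
  let ?A = "{n. unorm (zcoord x n) \<ge> 1}"
  have "range (\<lambda>n. unorm (zcoord x n)) \<subseteq> (\<lambda>n. unorm (zcoord x n)) ` ?A \<union> {..1}"
    by auto
  moreover have "bdd_above ((\<lambda>n. unorm (zcoord x n)) ` ?A)"
    by (intro bdd_above_finite finite_imageI finite_zcoord_ge) simp
  ultimately show ?thesis
    by (meson bdd_above_Iic bdd_above_Un bdd_above_mono)
qed

lemma zsum_closed_add:
  fixes x y :: "int \<Rightarrow> 'x::nonarch_normed_group"
  assumes "\<forall>e>0. finite {n. unorm (x n) \<ge> e}" "\<forall>e>0. finite {n. unorm (y n) \<ge> e}"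
  shows "\<forall>e>0. finite {n. unorm (x n + y n) \<ge> e}"
proof safe
  fix e :: real assume "e > 0"
  have "unorm (x n) \<ge> e \<or> unorm (y n) \<ge> e" if "unorm (x n + y n) \<ge> e" for n
    using nonarch_norm_add[of "x n" "y n"] that by linarith
  then have "{n. unorm (x n + y n) \<ge> e} \<subseteq> {n. unorm (x n) \<ge> e} \<union> {n. unorm (y n) \<ge> e}"
    by blast
  then show "finite {n. unorm (x n + y n) \<ge> e}"
    using assms \<open>e > 0\<close> by (meson finite_UnI finite_subset)
qed

instantiation zsum :: (nonarch_normed_group) ab_group_add
begin

lift_definition zero_zsum :: "'a zsum" is "\<lambda>_. 0"
  by (simp add: nonarch_norm_zero)

lift_definition plus_zsum :: "'a zsum \<Rightarrow> 'a zsum \<Rightarrow> 'a zsum" is "\<lambda>x y n. x n + y n"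
  unfolding zsum_limit_iff by (rule zsum_closed_add)

lift_definition uminus_zsum :: "'a zsum \<Rightarrow> 'a zsum" is "\<lambda>x n. - x n"
  by (simp add: nonarch_norm_minus)

definition minus_zsum :: "'a zsum \<Rightarrow> 'a zsum \<Rightarrow> 'a zsum" where
  "minus_zsum x y = x + (- y)"

instance
  by standard (simp_all only: minus_zsum_def, (transfer; simp add: ac_simps)+)

end

lemma zcoord_zero [simp]: "zcoord 0 n = 0"
  and zcoord_add [simp]: "zcoord (x + y) n = zcoord x n + zcoord y n"
  and zcoord_minus [simp]: "zcoord (- x) n = - zcoord x n"
  by (transfer; simp)+

lemma zcoord_diff [simp]: "zcoord (x - y) n = zcoord x n - zcoord y n"
  unfolding minus_zsum_def zcoord_add zcoord_minus by simp

lemma zsum_eqI: "(\<And>n. zcoord x n = zcoord y n) \<Longrightarrow> x = y"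
  by (metis ext zcoord_inject)

instantiation zsum :: (nonarch_normed_group) nonarch_normed_group
begin

definition unorm_zsum :: "'a zsum \<Rightarrow> real" where
  "unorm_zsum x = (SUP n. unorm (zcoord x n))"

definition dist_zsum :: "'a zsum \<Rightarrow> 'a zsum \<Rightarrow> real" where
  "dist_zsum x y = unorm (x - y)"

definition uniformity_zsum :: "('a zsum \<times> 'a zsum) filter" where
  "uniformity_zsum = (INF e\<in>{0 <..}. principal {(x, y). dist x y < e})"

definition open_zsum :: "'a zsum set \<Rightarrow> bool" where
  "open_zsum S = (\<forall>x\<in>S. \<forall>\<^sub>F (x', y) in uniformity. x' = x \<longrightarrow> y \<in> S)"

instance
proof
  fix x y z :: "'a zsum"
  have le: "unorm (zcoord z n) \<le> unorm z" for z :: "'a zsum" and n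
    unfolding unorm_zsum_def by (rule cSUP_upper[OF _ bdd_above_zcoord]) simp
  have ge: "0 \<le> unorm z" for z :: "'a zsum"
    using le[of z 0] nonarch_norm_ge_0[of "zcoord z 0"] by simp
  have zero: "unorm x = 0 \<longleftrightarrow> x = 0" for x :: "'a zsum"
  proof
    assume "unorm x = 0"
    then have "unorm (zcoord x n) = 0" for n
      using le[of x n] nonarch_norm_ge_0[of "zcoord x n"] by simp
    then show "x = 0" by (intro zsum_eqI) (simp add: nonarch_norm_eq_0_iff)
  qed (simp add: unorm_zsum_def nonarch_norm_zero)
  have minus: "unorm (- x) = unorm x" for x :: "'a zsum"
    by (simp add: unorm_zsum_def nonarch_norm_minus)
  have add: "unorm (x + y) \<le> max (unorm x) (unorm y)" for x y :: "'a zsum"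
  proof -
    have "unorm (zcoord (x + y) n) \<le> max (unorm x) (unorm y)" for n
      using nonarch_norm_add[of "zcoord x n" "zcoord y n"] le[of x n] le[of y n] by simp
    then show ?thesis
      unfolding unorm_zsum_def[of "x + y"] by (intro cSUP_least) auto
  qed
  show "unorm x = 0 \<longleftrightarrow> x = 0" "unorm (- x) = unorm x"
    "unorm (x + y) \<le> max (unorm x) (unorm y)"
    by (rule zero minus add)+
  show "dist x y = 0 \<longleftrightarrow> x = y" by (simp add: dist_zsum_def zero)
  have "dist x y \<le> max (dist x z) (dist y z)"
    unfolding dist_zsum_def using add[of "x - z" "- (y - z)"] unfolding minus by simp
  then show "dist x y \<le> dist x z + dist y z"
    using ge[of "x - z"] ge[of "y - z"] by (simp add: dist_zsum_def)
qed (rule dist_zsum_def uniformity_zsum_def open_zsum_def)+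

end

lemma norm_zcoord_le: "unorm (zcoord x n) \<le> unorm x"
  unfolding unorm_zsum_def by (rule cSUP_upper[OF _ bdd_above_zcoord]) simp

lemma norm_zsum_le: "(\<And>n. unorm (zcoord x n) \<le> B) \<Longrightarrow> unorm x \<le> B"
  unfolding unorm_zsum_def by (intro cSUP_least) auto

instance zsum :: (nonarch_banach_group) nonarch_banach_group
proof
  fix X :: "nat \<Rightarrow> 'a zsum" assume X: "Cauchy X"
  have near: "unorm (zcoord (X m) n - zcoord (X k) n) \<le> dist (X m) (X k)" for m k n
    using norm_zcoord_le[of "X m - X k" n] by (simp add: dist_unorm)
  have "Cauchy (\<lambda>m. zcoord (X m) n)" for n
    unfolding Cauchy_def dist_unorm[of "zcoord _ _"]
  proof (intro allI impI)
    fix e :: real assume "e > 0"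
    then obtain M where "\<forall>m\<ge>M. \<forall>k\<ge>M. dist (X m) (X k) < e"
      using X unfolding Cauchy_def by blast
    then show "\<exists>M. \<forall>m\<ge>M. \<forall>k\<ge>M. unorm (zcoord (X m) n - zcoord (X k) n) < e"
      using near[of _ n] by (blast intro: order_le_less_trans)
  qed
  then have "\<exists>l. (\<lambda>m. zcoord (X m) n) \<longlonglongrightarrow> l" for n
    using Cauchy_convergent convergent_def by blast
  then obtain L where L: "\<And>n. (\<lambda>m. zcoord (X m) n) \<longlonglongrightarrow> L n" by metis
  have unif: "\<exists>N. \<forall>m\<ge>N. \<forall>n. unorm (zcoord (X m) n - L n) \<le> e" if e: "e > 0" for e
  proof -
    obtain N where N: "\<forall>m\<ge>N. \<forall>k\<ge>N. dist (X m) (X k) < e"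
      using X e unfolding Cauchy_def by blast
    have "unorm (zcoord (X m) n - L n) \<le> e" if m: "m \<ge> N" for m n
    proof -
      have "(\<lambda>k. dist (zcoord (X m) n) (zcoord (X k) n)) \<longlonglongrightarrow> dist (zcoord (X m) n) (L n)"
        by (intro tendsto_intros L)
      moreover have "\<forall>k\<ge>N. dist (zcoord (X m) n) (zcoord (X k) n) \<le> e"
        using near[of m n] N m unfolding dist_unorm[of "zcoord _ _"]
        by (blast intro: order_trans order_less_imp_le)
      ultimately have "dist (zcoord (X m) n) (L n) \<le> e"
        by (blast intro: LIMSEQ_le_const2)
      then show ?thesis by (simp add: dist_unorm)
    qed
    then show ?thesis by blast
  qed
  have fin: "finite {n. unorm (L n) \<ge> e}" if e: "e > 0" for e
  proof -
    obtain N where N: "\<And>n. unorm (zcoord (X N) n - L n) \<le> e / 2"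
      using unif[of "e / 2"] e by auto
    have "unorm (zcoord (X N) n) \<ge> e" if "unorm (L n) \<ge> e" for n
    proof -
      have "unorm (L n) \<le> max (unorm (zcoord (X N) n)) (unorm (zcoord (X N) n - L n))"
        using nonarch_norm_diff[of "zcoord (X N) n" "zcoord (X N) n - L n"] by simp
      with N[of n] e that show ?thesis by linarith
    qed
    then have "{n. unorm (L n) \<ge> e} \<subseteq> {n. unorm (zcoord (X N) n) \<ge> e}" by blast
    then show ?thesis using finite_zcoord_ge[OF e] finite_subset by blast
  qed
  have zL: "zcoord (Abs_zsum L) = L" by (rule zcoord_Abs_zsum) (rule fin)
  have "X \<longlonglongrightarrow> Abs_zsum L"
    unfolding lim_sequentially
  proof safe
    fix e :: real assume e: "e > 0"
    then obtain N where N: "\<And>m n. m \<ge> N \<Longrightarrow> unorm (zcoord (X m) n - L n) \<le> e / 2"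
      using unif[of "e / 2"] by auto
    have "dist (X m) (Abs_zsum L) \<le> e / 2" if "m \<ge> N" for m
      unfolding dist_unorm by (rule norm_zsum_le) (simp only: zL zcoord_diff N[OF that])
    moreover have "e / 2 < e" using e by simp
    ultimately show "\<exists>N. \<forall>m\<ge>N. dist (X m) (Abs_zsum L) < e"
      by (blast intro: order_le_less_trans)
  qed
  then show "convergent X" unfolding convergent_def by blast
qed

text \<open>
  The argument of \<open>Abs_zsum\<close> is a null sequence whenever \<open>smul\<close> makes \<open>'x\<close> a
  \<open>nonarch_banach_space\<close>.
\<close>

definition zsum_smul ::
  "('k::nonarch_valued_field \<Rightarrow> 'x::nonarch_banach_group \<Rightarrow> 'x) \<Rightarrow> 'k \<Rightarrow> 'x zsum \<Rightarrow> 'x zsum"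
  where "zsum_smul smul a x = Abs_zsum (\<lambda>n. smul a (zcoord x n))"

definition zsum_ip ::
  "('x::nonarch_banach_group \<Rightarrow> 'x \<Rightarrow> 'k::nonarch_valued_field) \<Rightarrow> 'x zsum \<Rightarrow> 'x zsum \<Rightarrow> 'k"
  where "zsum_ip ip x y = (\<Sum>\<^sub>\<infinity>n. ip (zcoord x n) (zcoord y n))"

text \<open>The embedding of \<open>'x\<close> as the summand of index \<open>0\<close>.\<close>

lift_definition zsum_embed :: "'x::nonarch_normed_group \<Rightarrow> 'x zsum"
  is "\<lambda>x n. if n = 0 then x else 0"
  unfolding zsum_limit_iff
proof safe
  fix x :: 'x and e :: real assume "e > 0"
  then have "{n :: int. unorm (if n = 0 then x else 0) \<ge> e} \<subseteq> {0}"
    by (auto simp: nonarch_norm_zero split: if_splits)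
  then show "finite {n :: int. unorm (if n = 0 then x else 0) \<ge> e}"
    using finite_subset by blast
qed

definition zsum_proj :: "'x::nonarch_normed_group zsum \<Rightarrow> 'x"
  where "zsum_proj x = zcoord x 0"

text \<open>
  The operator of an infinite matrix of operators.  Its value at \<open>x\<close> is meaningful only if the
  row sums converge and form a null sequence.
\<close>

definition matrix_op ::
  "(int \<Rightarrow> int \<Rightarrow> 'x::nonarch_banach_group \<Rightarrow> 'x) \<Rightarrow> 'x zsum \<Rightarrow> 'x zsum"
  where "matrix_op u x = Abs_zsum (\<lambda>n. \<Sum>\<^sub>\<infinity>m. u n m (zcoord x m))"

definition dilation_matrix ::
  "('k::nonarch_valued_field \<Rightarrow> 'x::nonarch_banach_group \<Rightarrow> 'x) \<Rightarrow> ('x \<Rightarrow> 'x \<Rightarrow> 'k) \<Rightarrow>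
    ('x \<Rightarrow> 'x) \<Rightarrow> ('x \<Rightarrow> 'x) \<Rightarrow> ('x \<Rightarrow> 'x) \<Rightarrow> int \<Rightarrow> int \<Rightarrow> 'x \<Rightarrow> 'x"
  where "dilation_matrix smul ip T M N n m =
    (if n = 0 \<and> m = 0 then T
     else if n = 0 \<and> m = 1 then N
     else if n = -1 \<and> m = 0 then M
     else if n = -1 \<and> m = 1 then (\<lambda>x. - adj smul ip T x)
     else if n \<noteq> -1 \<and> n \<noteq> 0 \<and> m = n + 1 then id
     else (\<lambda>_. 0))"

context padic_hilbert_space
begin

lemma zcoord_zsum_smul: "zcoord (zsum_smul smul a x) n = smul a (zcoord x n)"
proof -
  have "finite {n. unorm (smul a (zcoord x n)) \<ge> e}" if e: "e > 0" for e
  proof (cases "a = 0")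
    case False
    then have "unorm a > 0"
      using nonarch_norm_eq_0_iff[of a] nonarch_norm_ge_0[of a] by simp
    then have "{n. unorm (smul a (zcoord x n)) \<ge> e} = {n. unorm (zcoord x n) \<ge> e / unorm a}"
      by (simp add: norm_smul field_simps)
    then show ?thesis using finite_zcoord_ge[of "e / unorm a" x] e \<open>unorm a > 0\<close> by simp
  qed (use e in \<open>simp add: nonarch_norm_zero\<close>)
  then show ?thesis unfolding zsum_smul_def by (subst zcoord_Abs_zsum) auto
qed

lemma zsum_ip_has_sum:
  "((\<lambda>n. ip (zcoord x n) (zcoord y n)) has_sum zsum_ip ip x y) UNIV"
proof -
  have "finite {n. unorm (ip (zcoord x n) (zcoord y n)) \<ge> e}" if e: "e > 0" for e
  proof -
    define c where "c = unorm y + 1"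
    have c: "c > 0" using nonarch_norm_ge_0[of y] by (simp add: c_def)
    have "unorm (zcoord x n) \<ge> e / c" if "unorm (ip (zcoord x n) (zcoord y n)) \<ge> e" for n
    proof -
      have "unorm (zcoord y n) \<le> c" using norm_zcoord_le[of y n] by (simp add: c_def)
      then have "unorm (zcoord x n) * unorm (zcoord y n) \<le> unorm (zcoord x n) * c"
        by (intro mult_left_mono nonarch_norm_ge_0)
      with ip_bound[of "zcoord x n" "zcoord y n"] that have "e \<le> unorm (zcoord x n) * c"
        by linarith
      with c show ?thesis by (simp add: field_simps)
    qed
    then have "{n. unorm (ip (zcoord x n) (zcoord y n)) \<ge> e} \<subseteq> {n. unorm (zcoord x n) \<ge> e / c}"
      by blast
    then show ?thesis using finite_zcoord_ge[of "e / c" x] e c finite_subset by auto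
  qed
  then have "(\<lambda>n. ip (zcoord x n) (zcoord y n)) summable_on UNIV"
    by (rule nonarch_summableI)
  then show ?thesis unfolding zsum_ip_def by (rule has_sum_infsum)
qed

theorem padic_hilbert_space_zsum: "padic_hilbert_space (zsum_smul smul) (zsum_ip ip)"
proof unfold_locales
  fix a b :: 'k and x y z :: "'x zsum"
  show "zsum_smul smul a (x + y) = zsum_smul smul a x + zsum_smul smul a y"
    "zsum_smul smul (a + b) x = zsum_smul smul a x + zsum_smul smul b x"
    "zsum_smul smul a (zsum_smul smul b x) = zsum_smul smul (a * b) x"
    "zsum_smul smul 1 x = x"
    by (auto intro!: zsum_eqI simp: zcoord_zsum_smul scale_right_distrib scale_left_distrib)
  show "unorm (zsum_smul smul a x) = unorm a * unorm x"
  proof (cases "a = 0")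
    case True
    then have "zsum_smul smul a x = 0" by (auto intro!: zsum_eqI simp: zcoord_zsum_smul)
    with True show ?thesis by (simp add: nonarch_norm_zero)
  next
    case False
    then have a: "unorm a > 0"
      using nonarch_norm_eq_0_iff[of a] nonarch_norm_ge_0[of a] by simp
    show ?thesis
    proof (rule antisym)
      show "unorm (zsum_smul smul a x) \<le> unorm a * unorm x"
        using a by (intro norm_zsum_le)
          (simp add: zcoord_zsum_smul norm_smul norm_zcoord_le mult_left_mono)
      have "unorm x \<le> unorm (zsum_smul smul a x) / unorm a"
      proof (rule norm_zsum_le)
        fix n
        show "unorm (zcoord x n) \<le> unorm (zsum_smul smul a x) / unorm a"
          using a norm_zcoord_le[of "zsum_smul smul a x" n]
          by (simp add: zcoord_zsum_smul norm_smul field_simps)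
      qed
      with a show "unorm a * unorm x \<le> unorm (zsum_smul smul a x)"
        by (simp add: field_simps)
    qed
  qed
  show "zsum_ip ip x y = zsum_ip ip y x"
    unfolding zsum_ip_def by (simp add: ip_sym)
  show "zsum_ip ip (zsum_smul smul a x + y) z = a * zsum_ip ip x z + zsum_ip ip y z"
  proof -
    have cont: "(\<lambda>t. a * t) \<midarrow>s\<rightarrow> a * s" for s :: 'k
    proof -
      have "((\<lambda>t. unorm a * unorm (t - s)) \<longlongrightarrow> unorm a * 0) (at s)"
        using tendsto_ident_at[of s UNIV] unfolding tendsto_nonarch_iff[of "\<lambda>t. t"]
        by (intro tendsto_mult tendsto_const)
      then show ?thesis
        unfolding tendsto_nonarch_iff[of "\<lambda>t. a * t"]
        by (simp add: nonarch_norm_mult flip: right_diff_distrib)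
    qed
    have "((\<lambda>t. a * t) \<circ> (\<lambda>n. ip (zcoord x n) (zcoord z n)) has_sum a * zsum_ip ip x z) UNIV"
      by (rule has_sum_comm_additive[OF _ cont zsum_ip_has_sum])
         (simp add: Modules.additive_def ring_distribs)
    from has_sum_add[OF this zsum_ip_has_sum[of y z]]
    have "((\<lambda>n. ip (zcoord (zsum_smul smul a x + y) n) (zcoord z n))
        has_sum (a * zsum_ip ip x z + zsum_ip ip y z)) UNIV"
      by (simp add: o_def zcoord_zsum_smul ip_linear)
    then show ?thesis using has_sum_unique zsum_ip_has_sum by blast
  qed
  show "unorm (zsum_ip ip x y) \<le> unorm x * unorm y"
  proof (rule nonarch_norm_has_sum_le[OF zsum_ip_has_sum])
    fix n
    have "unorm (zcoord x n) * unorm (zcoord y n) \<le> unorm x * unorm y"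
      by (intro mult_mono norm_zcoord_le nonarch_norm_ge_0)
    then show "unorm (ip (zcoord x n) (zcoord y n)) \<le> unorm x * unorm y"
      using ip_bound order_trans by blast
  qed (simp add: nonarch_norm_ge_0)
next
  fix x :: "'x zsum"
  assume orth: "\<And>y. zsum_ip ip x y = 0"
  show "x = 0"
  proof (rule zsum_eqI)
    fix k
    have "ip (zcoord x k) v = 0" for v
    proof -
      define f where "f = (\<lambda>n. if n = k then v else 0)"
      have "{n. unorm (f n) \<ge> e} \<subseteq> {k}" if "e > 0" for e
        using that by (auto simp: f_def nonarch_norm_zero split: if_splits)
      then have f: "zcoord (Abs_zsum f) = f"
        by (intro zcoord_Abs_zsum) (meson finite.emptyI finite.insertI finite_subset)
      have zr: "ip u 0 = 0" for u using ip_zero_left ip_sym by metis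
      have "((\<lambda>n. ip (zcoord x n) (f n)) has_sum ip (zcoord x k) v) UNIV"
        by (rule has_sum_finite_neutralI[of "{k}"]) (auto simp: f_def zr)
      with zsum_ip_has_sum[of x "Abs_zsum f"] have "zsum_ip ip x (Abs_zsum f) = ip (zcoord x k) v"
        unfolding f using has_sum_unique by blast
      then show ?thesis using orth by simp
    qed
    then show "zcoord x k = zcoord 0 k" using ip_nondegenerate by simp
  qed
qed

end

end

theory Submission
  imports Defs
begin

text \<open>
  On coordinates \<open>U\<close> is the left shift corrected by the \<open>2 \<times> 2\<close> Halmos block
  $(M, -T^*; T, N)$, so its adjoint is the right shift corrected by the transposed block, and
  unitarity reduces to the block identities, the only nontrivial one being $M T^* = T^* N$
  (the adjoint of $T M = N T$).  The sequences vanishing at all positive indices are invariant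
  under \<open>U\<close>, and on them the coordinate of index \<open>0\<close> evolves by \<open>T\<close>; for the adjoint use the
  sequences vanishing at all negative indices.
\<close>

lemma zcoord_Abs_zsum_shift:
  fixes x :: "'x::nonarch_normed_group zsum"
  assumes "finite A" and "\<And>n. n \<notin> A \<Longrightarrow> f n = zcoord x (n + k)"
  shows "zcoord (Abs_zsum f) = f"
proof (rule zcoord_Abs_zsum)
  fix e :: real assume e: "e > 0"
  have "{n. unorm (f n) \<ge> e} \<subseteq> A \<union> (\<lambda>m. m - k) ` {m. unorm (zcoord x m) \<ge> e}"
  proof
    fix n assume n: "n \<in> {n. unorm (f n) \<ge> e}"
    show "n \<in> A \<union> (\<lambda>m. m - k) ` {m. unorm (zcoord x m) \<ge> e}"
    proof (cases "n \<in> A")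
      case False
      with n assms(2) have "n + k \<in> {m. unorm (zcoord x m) \<ge> e}" by simp
      then show ?thesis by (auto intro: image_eqI[of _ _ "n + k"])
    qed simp
  qed
  with assms(1) finite_zcoord_ge[OF e, of x] show "finite {n. unorm (f n) \<ge> e}"
    by (meson finite_Un finite_imageI finite_subset)
qed

lemma bounded_linear_op_bound:
  assumes "bounded_linear_op smul T"
  obtains C where "0 \<le> C" "\<And>x. unorm (T x) \<le> C * unorm x"
proof -
  from assms obtain C where C: "\<And>x. unorm (T x) \<le> C * unorm x"
    unfolding bounded_linear_op_def by blast
  have "unorm (T x) \<le> \<bar>C\<bar> * unorm x" for x
    using C[of x] mult_right_mono[OF abs_ge_self nonarch_norm_ge_0] by (rule order_trans)
  then show ?thesis by (intro that[of "\<bar>C\<bar>"]) auto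
qed

lemma bounded_linear_op_add: "bounded_linear_op smul T \<Longrightarrow> T (x + y) = T x + T y"
  unfolding bounded_linear_op_def
  by (blast dest: Vector_Spaces.linear.axioms(3) intro: module_hom.add)

lemma bounded_linear_op_scale: "bounded_linear_op smul T \<Longrightarrow> T (smul a x) = smul a (T x)"
  unfolding bounded_linear_op_def
  by (blast dest: Vector_Spaces.linear.axioms(3) intro: module_hom.scale)

lemma bounded_linear_op_zero: "bounded_linear_op smul T \<Longrightarrow> T 0 = 0"
  using bounded_linear_op_add[of smul T 0 0] by simp

lemma bounded_linear_op_diff:
  assumes "bounded_linear_op smul T"
  shows "T (x - y) = T x - T y"
  using bounded_linear_op_add[OF assms, of "x - y" y] by simp

context padic_hilbert_space
begin

lemma ip_diff_left: "ip (x - y) z = ip x z - ip y z"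
  by (metis ip_diff_right ip_sym)

lemma bounded_linear_op_zsumI:
  assumes add: "\<And>x y n. zcoord (W (x + y)) n = zcoord (W x) n + zcoord (W y) n"
    and scale: "\<And>a x n. zcoord (W (zsum_smul smul a x)) n = smul a (zcoord (W x) n)"
    and bound: "\<And>x n. unorm (zcoord (W x) n) \<le> C * unorm x"
  shows "bounded_linear_op (zsum_smul smul) W"
  unfolding bounded_linear_op_def
proof
  show "Vector_Spaces.linear (zsum_smul smul) (zsum_smul smul) W"
    by unfold_locales (auto intro!: zsum_eqI simp: add scale zcoord_zsum_smul
        scale_right_distrib scale_left_distrib)
  show "\<exists>C. \<forall>x. unorm (W x) \<le> C * unorm x"
    using bound by (blast intro: norm_zsum_le)
qed

end

locale dilation_data = padic_hilbert_space smul ip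
  for smul :: "'k::nonarch_valued_field \<Rightarrow> 'x::nonarch_banach_group \<Rightarrow> 'x"
    and ip :: "'x \<Rightarrow> 'x \<Rightarrow> 'k" +
  fixes T M N :: "'x \<Rightarrow> 'x"
  assumes adjointable: "adjointable smul ip T"
    and roots: "magic_roots smul ip T M N"
begin

abbreviation "S \<equiv> adj smul ip T"
abbreviation "U \<equiv> matrix_op (dilation_matrix smul ip T M N)"

definition V :: "'x zsum \<Rightarrow> 'x zsum" where
  "V y = Abs_zsum (\<lambda>n. if n = 0 then M (zcoord y (-1)) + S (zcoord y 0)
    else if n = 1 then N (zcoord y 0) - T (zcoord y (-1)) else zcoord y (n - 1))"

sublocale zsum: padic_hilbert_space "zsum_smul smul" "zsum_ip ip"
  by (rule padic_hilbert_space_zsum)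

lemma bounded_ops:
  "bounded_linear_op smul T" "bounded_linear_op smul S"
  "bounded_linear_op smul M" "bounded_linear_op smul N"
  using adjointable roots is_adjoint_adj[OF adjointable]
  by (auto simp: adjointable_def magic_roots_def self_adjoint_def is_adjoint_def)

lemmas ops_add = bounded_ops[THEN bounded_linear_op_add]
lemmas ops_scale = bounded_ops[THEN bounded_linear_op_scale]
lemmas ops_zero = bounded_ops[THEN bounded_linear_op_zero]
lemmas ops_diff = bounded_ops[THEN bounded_linear_op_diff]

lemma ip_T: "ip (T x) y = ip x (S y)"
  using is_adjoint_adj[OF adjointable] by (simp add: is_adjoint_def)

lemma ip_S: "ip (S x) y = ip x (T y)"
  using ip_T[of y x] by (metis ip_sym)

lemma ip_M: "ip (M x) y = ip x (M y)"
  using roots is_adjoint_adj[of M] by (simp add: magic_roots_def self_adjoint_def is_adjoint_def)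

lemma ip_N: "ip (N x) y = ip x (N y)"
  using roots is_adjoint_adj[of N] by (simp add: magic_roots_def self_adjoint_def is_adjoint_def)

lemma MM: "M (M x) = x - S (T x)"
  and NN: "N (N x) = x - T (S x)"
  and TM: "T (M x) = N (T x)"
  using roots by (auto simp: magic_roots_def fun_eq_iff)

lemma MS: "M (S x) = S (N x)"
proof -
  have "ip (M (S x) - S (N x)) z = 0" for z
    by (simp add: ip_diff_left ip_M ip_S ip_N TM)
  then have "M (S x) - S (N x) = 0" by (rule ip_nondegenerate)
  then show ?thesis by simp
qed

lemma dilation_row_sum:
  "(\<Sum>\<^sub>\<infinity>m. dilation_matrix smul ip T M N n m (zcoord x m)) =
    (if n = -1 then M (zcoord x 0) - S (zcoord x 1)
     else if n = 0 then T (zcoord x 0) + N (zcoord x 1)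
     else zcoord x (n + 1))"
    (is "infsum ?f UNIV = _")
proof -
  define F where "F = (if n = -1 \<or> n = 0 then {0, 1} else {n + 1})"
  have "infsum ?f UNIV = infsum ?f F"
    by (rule infsum_cong_neutral) (auto simp: F_def dilation_matrix_def)
  also have "\<dots> = sum ?f F"
    by (rule infsum_finite) (simp add: F_def)
  finally show ?thesis by (simp add: F_def dilation_matrix_def)
qed

lemma zcoord_U:
  "zcoord (U x) n =
    (if n = -1 then M (zcoord x 0) - S (zcoord x 1)
     else if n = 0 then T (zcoord x 0) + N (zcoord x 1)
     else zcoord x (n + 1))"
  unfolding matrix_op_def dilation_row_sum
  by (subst zcoord_Abs_zsum_shift[where A = "{-1, 0}" and k = 1]) auto

lemma zcoord_V:
  "zcoord (V y) n = (if n = 0 then M (zcoord y (-1)) + S (zcoord y 0)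
    else if n = 1 then N (zcoord y 0) - T (zcoord y (-1)) else zcoord y (n - 1))"
  unfolding V_def
  by (subst zcoord_Abs_zsum_shift[where A = "{0, 1}" and k = "-1"]) auto

lemma ops_bound:
  obtains C where "\<And>x n. unorm (T (zcoord x n)) \<le> C * unorm x"
    "\<And>x n. unorm (S (zcoord x n)) \<le> C * unorm x"
    "\<And>x n. unorm (M (zcoord x n)) \<le> C * unorm x" "\<And>x n. unorm (N (zcoord x n)) \<le> C * unorm x"
    "\<And>(x :: 'x zsum) n. unorm (zcoord x n) \<le> C * unorm x"
proof -
  from bounded_ops[THEN bounded_linear_op_bound] obtain a b c d where
    C: "0 \<le> a" "\<And>x. unorm (T x) \<le> a * unorm x" "0 \<le> b" "\<And>x. unorm (S x) \<le> b * unorm x"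
    "0 \<le> c" "\<And>x. unorm (M x) \<le> c * unorm x" "0 \<le> d" "\<And>x. unorm (N x) \<le> d * unorm x"
    by metis
  define B where "B = 1 + a + b + c + d"
  have le: "t * unorm (zcoord x n) \<le> B * unorm x" if "t \<le> B" for t and x :: "'x zsum" and n
    using that C by (intro mult_mono norm_zcoord_le nonarch_norm_ge_0) (auto simp: B_def)
  show ?thesis
  proof (rule that[of B])
    fix x :: "'x zsum" and n
    show "unorm (T (zcoord x n)) \<le> B * unorm x"
      using C by (intro order_trans[OF C(2) le]) (simp add: B_def)
    show "unorm (S (zcoord x n)) \<le> B * unorm x"
      using C by (intro order_trans[OF C(4) le]) (simp add: B_def)
    show "unorm (M (zcoord x n)) \<le> B * unorm x"
      using C by (intro order_trans[OF C(6) le]) (simp add: B_def)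
    show "unorm (N (zcoord x n)) \<le> B * unorm x"
      using C by (intro order_trans[OF C(8) le]) (simp add: B_def)
    show "unorm (zcoord x n) \<le> B * unorm x"
      using le[of 1 x n] C by (simp add: B_def)
  qed
qed

lemma bounded_U_V: "bounded_linear_op (zsum_smul smul) U" "bounded_linear_op (zsum_smul smul) V"
proof -
  obtain C where C:
    "\<And>x n. unorm (T (zcoord x n)) \<le> C * unorm x" "\<And>x n. unorm (S (zcoord x n)) \<le> C * unorm x"
    "\<And>x n. unorm (M (zcoord x n)) \<le> C * unorm x" "\<And>x n. unorm (N (zcoord x n)) \<le> C * unorm x"
    "\<And>(x :: 'x zsum) n. unorm (zcoord x n) \<le> C * unorm x"
    using ops_bound by blast
  show "bounded_linear_op (zsum_smul smul) U" "bounded_linear_op (zsum_smul smul) V"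
    by (rule bounded_linear_op_zsumI[where C = C];
        auto simp: zcoord_U zcoord_V zcoord_zsum_smul ops_add ops_scale scale_right_distrib
          scale_right_diff_distrib C
          intro: order_trans[OF nonarch_norm_add] order_trans[OF nonarch_norm_diff])+
qed

lemma zsum_ip_U: "zsum_ip ip (U x) y = zsum_ip ip x (V y)"
proof -
  define a where "a n = ip (zcoord (U x) n) (zcoord y n)" for n
  define b where "b n = ip (zcoord x n) (zcoord (V y) n)" for n
  have "bij (\<lambda>n::int. n + 1)"
    by (rule bij_betw_byWitness[where f' = "\<lambda>n. n - 1"]) auto
  then have "((\<lambda>n. b (n + 1)) has_sum zsum_ip ip x (V y)) UNIV"
    using zsum_ip_has_sum[of x "V y"] unfolding b_def[symmetric]
    by (subst has_sum_reindex_bij_betw[where g = "\<lambda>n. n + 1" and f = b]) auto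
  then have "((\<lambda>n. - b (n + 1)) has_sum - zsum_ip ip x (V y)) UNIV"
    by (simp add: has_sum_uminus)
  from has_sum_add[OF zsum_ip_has_sum[of "U x" y] this]
  have *: "((\<lambda>n. a n - b (n + 1)) has_sum zsum_ip ip (U x) y - zsum_ip ip x (V y)) UNIV"
    by (simp add: a_def)
  have "((\<lambda>n. a n - b (n + 1)) has_sum 0) UNIV"
  proof (rule has_sum_finite_neutralI[of "{-1, 0}"])
    show "0 = (\<Sum>n\<in>{-1, 0}. a n - b (n + 1))"
      by (simp add: a_def b_def zcoord_U zcoord_V ip_diff_left ip_diff_right ip_add_left
          ip_add_right ip_T ip_S ip_M ip_N)
  qed (auto simp: a_def b_def zcoord_U zcoord_V)
  with * have "zsum_ip ip (U x) y - zsum_ip ip x (V y) = 0" by (rule has_sum_unique)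
  then show ?thesis by simp
qed

lemma is_adjoint_V: "is_adjoint (zsum_smul smul) (zsum_ip ip) U V"
  unfolding is_adjoint_def using bounded_U_V zsum_ip_U by blast

lemma adj_U: "adj (zsum_smul smul) (zsum_ip ip) U = V"
  using is_adjoint_V by (rule zsum.adj_eqI)

lemma U_V: "U (V y) = y"
  by (rule zsum_eqI) (simp add: zcoord_U zcoord_V ops_add ops_diff MM NN TM MS)

lemma V_U: "V (U x) = x"
  by (rule zsum_eqI) (simp add: zcoord_U zcoord_V ops_add ops_diff MM NN TM MS)

lemma unitary_U: "unitary (zsum_smul smul) (zsum_ip ip) U"
  unfolding unitary_def adj_U adjointable_def
  using bounded_U_V is_adjoint_V by (auto simp: U_V V_U)

lemma zcoord_U_power_embed:
  "zcoord ((U ^^ n) (zsum_embed x)) 0 = (T ^^ n) x \<and>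
    (\<forall>k>0. zcoord ((U ^^ n) (zsum_embed x)) k = 0)"
  by (induction n) (auto simp: zcoord_U zsum_embed.rep_eq ops_zero)

lemma zcoord_V_power_embed:
  "zcoord ((V ^^ n) (zsum_embed x)) 0 = (S ^^ n) x \<and>
    (\<forall>k<0. zcoord ((V ^^ n) (zsum_embed x)) k = 0)"
  by (induction n) (auto simp: zcoord_V zsum_embed.rep_eq ops_zero)

end

theorem theorem2p9:
  fixes smul :: "'k::nonarch_valued_field \<Rightarrow> 'x::nonarch_banach_group \<Rightarrow> 'x"
    and ip :: "'x \<Rightarrow> 'x \<Rightarrow> 'k"
    and T M N :: "'x \<Rightarrow> 'x"
    and U :: "'x zsum \<Rightarrow> 'x zsum"
  assumes "padic_hilbert_space smul ip"
    and "magic_contraction smul ip T"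
    and "magic_roots smul ip T M N"
    and "U = matrix_op (dilation_matrix smul ip T M N)"
  shows "unitary (zsum_smul smul) (zsum_ip ip) U \<and>
    (\<forall>n. T ^^ n = zsum_proj \<circ> (U ^^ n) \<circ> zsum_embed) \<and>
    (\<forall>n. adj smul ip T ^^ n =
       zsum_proj \<circ> (adj (zsum_smul smul) (zsum_ip ip) U ^^ n) \<circ> zsum_embed)"
proof -
  interpret padic_hilbert_space smul ip by fact
  interpret dilation_data smul ip T M N
    using assms(2,3) by unfold_locales (auto simp: magic_contraction_def)
  show ?thesis
    unfolding assms(4) adj_U
    using unitary_U zcoord_U_power_embed zcoord_V_power_embed
    by (auto simp: fun_eq_iff zsum_proj_def)
qed

end
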